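(* For all integers $d\ge2$, the Gotzmann threshold of $x_2^d$ in $R_5$ is $$\tau_5(x_2^d)=\binom{\binom{\binom d2}{2}+\binom{d+1}{3}+\binom d2}{2}-\binom{\binom d2}{3}+\binom{d+3}{4}-d.$$
   Context: $K$ is a field, $R_n=K[x_1,\dots,x_n]$ with the standard grading, $S_n$ is the set of monomials of $R_n$ and $S_{n,d}$ the set of those of degree $d$, ordered lexicographically with $x_1^d$ largest and $x_n^d$ smallest. For $u\in S_{n,d}$, $B(u)\subseteq S_{n,d}$ is the smallest set of monomials containing $u$ and stable under $v\mapsto vx_i/x_j$ whenever $x_j\mid v$ and $i\le j$, and $\langle u\rangle\subseteq R_n$ is the ideal generated by $B(u)$, i.e. the smallest Borel-stable (strongly stable) monomial ideal of $R_n$ containing $u$. An ideal $I\subseteq R_n$ generated by monomials of a single degree $d$ is a Gotzmann ideal if its Hilbert function attains Macaulay's lower bound from degree $d$ on, i.e. for all $j\ge d$, $\dim_K I_{j+1}=|\{x_iv: v\in L,\,1\le i\le n\}|$, where $L$ is the set of the $\dim_K I_j$ lexicographically largest monomials of $S_{n,j}$ (by Gotzmann's persistence theorem it suffices to require this for $j=d$). $u\in S_n$ is a Gotzmann monomial in $R_n$ if $\langle u\rangle\subseteq R_n$ is a Gotzmann ideal. By a theorem of Gotzmann, for every $u\in S_n$ there is a unique integer $\tau_n(u)\ge0$, the Gotzmann threshold of $u$ in $R_n$, such that for integers $s\ge 0$, $ux_n^s$ is a Gotzmann monomial in $R_n$ if and only if $s\ge\tau_n(u)$. *)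

theory Defs
  imports Complex_Main "HOL-Library.Poly_Mapping" "HOL-Algebra.Ideal"
begin

text \<open>
  A monomial is represented by its exponent vector, so that the product of monomials is \<open>+\<close>,
  division by a variable is subtraction, and the variable \<open>x\<^sub>i\<close> (with \<open>i\<close> counted from 1) is
  \<open>single i 1\<close>. The library order \<open><\<close> on this type compares two exponent vectors at the least index
  where they differ; on monomials of a fixed degree it is therefore the lexicographic order
  with \<open>x\<^sub>1\<^sup>d\<close> largest.
\<close>

type_synonym pp = "nat \<Rightarrow>\<^sub>0 nat"

type_synonym 'k mpoly = "pp \<Rightarrow>\<^sub>0 'k"

abbreviation pvar :: "nat \<Rightarrow> pp" where
  "pvar i \<equiv> Poly_Mapping.single i 1"

abbreviation monomial :: "pp \<Rightarrow> 'k::field mpoly" where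
  "monomial v \<equiv> Poly_Mapping.single v 1"

definition pdeg :: "pp \<Rightarrow> nat" where
  "pdeg v = (\<Sum>i\<in>Poly_Mapping.keys v. Poly_Mapping.lookup v i)"

definition monomials :: "nat \<Rightarrow> pp set" where
  "monomials n = {v. Poly_Mapping.keys v \<subseteq> {1..n}}"

definition monomials_deg :: "nat \<Rightarrow> nat \<Rightarrow> pp set" where
  "monomials_deg n d = {v \<in> monomials n. pdeg v = d}"

definition poly_ring :: "'k::field itself \<Rightarrow> nat \<Rightarrow> 'k mpoly ring" where
  "poly_ring _ n =
    \<lparr> carrier = {p. Poly_Mapping.keys p \<subseteq> monomials n},
      monoid.mult = (*), one = 1, zero = 0, add = (+) \<rparr>"

definition mscale :: "'k::field \<Rightarrow> 'k mpoly \<Rightarrow> 'k mpoly" where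
  "mscale c p = Poly_Mapping.single 0 c * p"

definition homogeneous_part :: "'k::field mpoly set \<Rightarrow> nat \<Rightarrow> 'k mpoly set" where
  "homogeneous_part I j = {p \<in> I. \<forall>v\<in>Poly_Mapping.keys p. pdeg v = j}"

definition hilbert_fun :: "'k::field mpoly set \<Rightarrow> nat \<Rightarrow> nat" where
  "hilbert_fun I j = vector_space.dim mscale (homogeneous_part I j)"

text \<open>The \<open>k\<close> lexicographically largest monomials of degree \<open>j\<close>: those with fewer than \<open>k\<close>
  monomials of degree \<open>j\<close> above them.\<close>

definition lexsegment :: "nat \<Rightarrow> nat \<Rightarrow> nat \<Rightarrow> pp set" where
  "lexsegment n j k = {v \<in> monomials_deg n j. card {w \<in> monomials_deg n j. v < w} < k}"

text \<open>The degree \<open>d\<close> of the generators is determined by the ideal unless the ideal is zero, in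
  which case the numerical condition holds trivially for every \<open>d\<close>.\<close>

definition gotzmann_ideal :: "nat \<Rightarrow> 'k::field mpoly set \<Rightarrow> bool" where
  "gotzmann_ideal n I \<longleftrightarrow>
    (\<exists>d. \<exists>G \<subseteq> monomials_deg n d.
       I = genideal (poly_ring TYPE('k) n) (monomial ` G) \<and>
       (\<forall>j\<ge>d. hilbert_fun I (Suc j) =
          card {pvar i + v | i v. i \<in> {1..n} \<and> v \<in> lexsegment n j (hilbert_fun I j)}))"

inductive_set borel_closure :: "pp \<Rightarrow> pp set" for u :: pp where
  base: "u \<in> borel_closure u"
| step: "\<lbrakk>v \<in> borel_closure u; Poly_Mapping.lookup v j > 0; 1 \<le> i; i \<le> j\<rbrakk>
    \<Longrightarrow> v - pvar j + pvar i \<in> borel_closure u"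

definition borel_ideal :: "'k::field itself \<Rightarrow> nat \<Rightarrow> pp \<Rightarrow> 'k mpoly set" where
  "borel_ideal K n u = genideal (poly_ring K n) (monomial ` borel_closure u)"

definition gotzmann_monomial :: "'k::field itself \<Rightarrow> nat \<Rightarrow> pp \<Rightarrow> bool" where
  "gotzmann_monomial K n u \<longleftrightarrow> u \<in> monomials n \<and> gotzmann_ideal n (borel_ideal K n u)"

definition gotzmann_threshold :: "'k::field itself \<Rightarrow> nat \<Rightarrow> pp \<Rightarrow> nat" where
  "gotzmann_threshold K n u =
    (THE t. \<forall>s. gotzmann_monomial K n (u + Poly_Mapping.single n s) \<longleftrightarrow> t \<le> s)"

lemma vector_space_mscale: "vector_space (mscale :: 'k::field \<Rightarrow> _)"
  by unfold_locales
    (simp_all add: mscale_def distrib_left distrib_right Poly_Mapping.single_add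
      Poly_Mapping.mult_single flip: mult.assoc Poly_Mapping.single_one)

lemma keys_add_monomials:
  assumes "v \<in> monomials n" "w \<in> monomials n"
  shows "v + w \<in> monomials n"
  using assms Poly_Mapping.keys_add[of v w] unfolding monomials_def by blast

lemma cring_poly_ring: "cring (poly_ring TYPE('k::field) n)"
proof -
  let ?C = "{p :: 'k mpoly. Poly_Mapping.keys p \<subseteq> monomials n}"
  have add: "p + q \<in> ?C" if "p \<in> ?C" "q \<in> ?C" for p q
    using that Poly_Mapping.keys_add[of p q] by blast
  have mult: "p * q \<in> ?C" if "p \<in> ?C" "q \<in> ?C" for p q
    using that keys_mult[of p q] keys_add_monomials[of _ n] by blast
  have neg: "\<exists>q\<in>?C. p + q = 0" if "p \<in> ?C" for p
    using that by (intro bexI[of _ "- p"]) (simp_all add: in_keys_iff subset_iff)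
  have one: "1 \<in> ?C" and zero: "0 \<in> ?C"
    by (simp_all add: monomials_def)
  show ?thesis
    using add mult neg one zero unfolding poly_ring_def
    by (intro cringI abelian_groupI comm_monoidI)
      (auto simp: algebra_simps)
qed

end

theory Submission
  imports Defs
begin

text \<open>
  The Borel closure of \<open>x\<^sub>2\<^sup>d x\<^sub>5\<^sup>s\<close> consists of the monomials of degree \<open>d + s\<close> whose degree in
  \<open>x\<^sub>1, x\<^sub>2\<close> is at least \<open>d\<close>, so the ideal it generates is \<open>(x\<^sub>1, x\<^sub>2)\<^sup>d\<close> truncated in degree
  \<open>d + s\<close>. Its Hilbert polynomial is that of the lexicographic ideal
  \<open>(x\<^sub>1, x\<^sub>2\<^sup>A\<^sup>+\<^sup>1, x\<^sub>2\<^sup>A x\<^sub>3\<^sup>b\<^sup>+\<^sup>1, x\<^sub>2\<^sup>A x\<^sub>3\<^sup>b x\<^sub>4\<^sup>c)\<close> for suitable \<open>A, b\<close> and \<open>c > 0\<close>, and the two Hilbert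
  functions agree from degree \<open>A + b + c - 1\<close> on. In these degrees the lexicographic segment with
  the required number of elements is therefore the corresponding part of the lexicographic ideal.
  It grows minimally from degree \<open>A + b + c\<close> on, where all generators are present, but not from
  degree \<open>A + b + c - 1\<close>, where the last generator is still missing. Hence the threshold is
  \<open>A + b + c - d\<close>.
\<close>

section \<open>Monomials\<close>

lemma pdeg_eq_sum:
  assumes "v \<in> monomials n"
  shows "pdeg v = (\<Sum>i=1..n. Poly_Mapping.lookup v i)"
  unfolding pdeg_def using assms
  by (intro sum.mono_neutral_left) (auto simp: monomials_def in_keys_iff)

lemma in_monomials_iff: "v \<in> monomials n \<longleftrightarrow> (\<forall>i. i \<notin> {1..n} \<longrightarrow> Poly_Mapping.lookup v i = 0)"
  by (auto simp: monomials_def in_keys_iff subset_iff)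

lemma in_monomials_add_iff [simp]: "v + w \<in> monomials n \<longleftrightarrow> v \<in> monomials n \<and> w \<in> monomials n"
  by (auto simp: in_monomials_iff lookup_add)

lemma in_monomials_single_iff [simp]:
  "Poly_Mapping.single i k \<in> monomials n \<longleftrightarrow> k = 0 \<or> i \<in> {1..n}"
  by (auto simp: in_monomials_iff lookup_single when_def)

lemma pdeg_add [simp]: "pdeg (v + w) = pdeg v + pdeg w"
proof -
  have *: "pdeg x = sum (Poly_Mapping.lookup x) (Poly_Mapping.keys v \<union> Poly_Mapping.keys w)"
    if "Poly_Mapping.keys x \<subseteq> Poly_Mapping.keys v \<union> Poly_Mapping.keys w" for x
    unfolding pdeg_def using that by (intro sum.mono_neutral_left) (auto simp: in_keys_iff)
  show ?thesis
    by (subst (1 2 3) *) (auto simp: lookup_add sum.distrib dest: subsetD[OF Poly_Mapping.keys_add])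
qed

lemma pdeg_single [simp]: "pdeg (Poly_Mapping.single i k) = k"
  by (simp add: pdeg_def)

lemma minus_pvar_add_pvar:
  assumes "Poly_Mapping.lookup v i > 0"
  shows "pvar i + (v - pvar i) = v"
  using assms by (intro poly_mapping_eqI) (auto simp: lookup_add lookup_minus lookup_single when_def)

lemma divide_pvar:
  assumes "v \<in> monomials_deg n (Suc j)" "Poly_Mapping.lookup v i > 0"
  obtains w where "w \<in> monomials_deg n j" "v = pvar i + w" "i \<in> {1..n}"
    "Poly_Mapping.lookup w i = Poly_Mapping.lookup v i - 1"
    "\<And>k. k \<noteq> i \<Longrightarrow> Poly_Mapping.lookup w k = Poly_Mapping.lookup v k"
proof
  have v: "v = pvar i + (v - pvar i)"
    using minus_pvar_add_pvar[OF assms(2)] by simp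
  show "v - pvar i \<in> monomials_deg n j" "i \<in> {1..n}"
    using assms(1) by (subst (asm) v, simp add: monomials_deg_def)+
  show "v = pvar i + (v - pvar i)" by (fact v)
qed (auto simp: lookup_minus lookup_single when_def)

section \<open>Monomial ideals\<close>

lemma poly_mapping_sum_single:
  "(\<Sum>v\<in>Poly_Mapping.keys p. Poly_Mapping.single v (Poly_Mapping.lookup p v)) = p"
  by (intro poly_mapping_eqI)
    (auto simp: lookup_sum lookup_single when_def sum.delta in_keys_iff)

text \<open>For \<open>G\<close> inside the ring these are the monomials of the ideal generated by
  \<open>G\<close>; \<open>genideal_monomials\<close> makes this precise.\<close>

definition monomial_multiples :: "nat \<Rightarrow> pp set \<Rightarrow> pp set" where
  "monomial_multiples n G = {g + w | g w. g \<in> G \<and> w \<in> monomials n}"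

lemma subset_monomial_multiples: "G \<subseteq> monomial_multiples n G"
proof
  fix g assume "g \<in> G"
  moreover have "g = g + 0" "0 \<in> monomials n" by (simp_all add: monomials_def)
  ultimately show "g \<in> monomial_multiples n G" unfolding monomial_multiples_def by blast
qed

lemma keys_mult_monomial_multiples:
  assumes "Poly_Mapping.keys p \<subseteq> monomial_multiples n G" "Poly_Mapping.keys q \<subseteq> monomials n"
  shows "Poly_Mapping.keys (p * q) \<subseteq> monomial_multiples n G"
proof
  fix v assume "v \<in> Poly_Mapping.keys (p * q)"
  then obtain a b where "v = a + b" "a \<in> Poly_Mapping.keys p" "b \<in> Poly_Mapping.keys q"
    using keys_mult[of p q] by blast
  with assms obtain g w where "v = g + (w + b)" "g \<in> G" "w \<in> monomials n" "b \<in> monomials n"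
    by (auto simp: monomial_multiples_def subset_iff add.assoc)
  then show "v \<in> monomial_multiples n G"
    using in_monomials_add_iff unfolding monomial_multiples_def by blast
qed

text \<open>Multiples of \<open>G\<close> stay multiples under multiplication by monomials, so the
  right-hand side is an ideal containing the generators. Conversely, a polynomial is the finite sum
  of its terms, and each term with exponent in \<open>monomial_multiples n G\<close> is a ring
  multiple of a generator.\<close>

lemma genideal_monomials:
  fixes G :: "pp set"
  assumes "G \<subseteq> monomials n"
  shows "genideal (poly_ring TYPE('k::field) n) (monomial ` G) =
    {p. Poly_Mapping.keys p \<subseteq> monomial_multiples n G}"
proof
  let ?R = "poly_ring TYPE('k) n"
  let ?J = "{p :: 'k mpoly. Poly_Mapping.keys p \<subseteq> monomial_multiples n G}"
  interpret R: cring ?R by (rule cring_poly_ring)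
  have sub: "monomial_multiples n G \<subseteq> monomials n"
    using assms by (auto simp: monomial_multiples_def)
  have closed: "p + q \<in> ?J" if "p \<in> ?J" "q \<in> ?J" for p q
    using that Poly_Mapping.keys_add[of p q] by blast
  \<comment> \<open>The record \<open>poly_ring\<close> carries no negation of its own, so the group
    inverse is identified by uniqueness.\<close>
  have minus: "\<ominus>\<^bsub>?R\<^esub> p = - p" if "p \<in> ?J" for p
    using that sub by (intro R.minus_equality) (auto simp: poly_ring_def)
  have J: "ideal ?J ?R"
  proof (intro idealI)
    show "ring ?R" by (rule R.ring_axioms)
    show "subgroup ?J (add_monoid ?R)"
    proof (rule group.subgroupI[OF R.add.is_group])
      show "?J \<subseteq> carrier (add_monoid ?R)" using sub by (auto simp: poly_ring_def)
      have "0 \<in> ?J" by simp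
      then show "?J \<noteq> {}" by blast
      show "inv\<^bsub>add_monoid ?R\<^esub> p \<in> ?J" if "p \<in> ?J" for p
        using minus[OF that] that by (simp add: a_inv_def)
      show "p \<otimes>\<^bsub>add_monoid ?R\<^esub> q \<in> ?J" if "p \<in> ?J" "q \<in> ?J" for p q
        using closed[OF that] by (simp add: poly_ring_def)
    qed
  next
    fix p q assume *: "p \<in> ?J" "q \<in> carrier ?R"
    then show "p \<otimes>\<^bsub>?R\<^esub> q \<in> ?J"
      using keys_mult_monomial_multiples[of p n G q] by (simp add: poly_ring_def)
    with * show "q \<otimes>\<^bsub>?R\<^esub> p \<in> ?J"
      by (simp add: poly_ring_def mult.commute)
  qed
  have "monomial ` G \<subseteq> ?J"
    using subset_monomial_multiples[of G n] by auto
  then show "genideal ?R (monomial ` G) \<subseteq> ?J"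
    using J by (intro R.genideal_minimal)
  show "?J \<subseteq> genideal ?R (monomial ` G)"
  proof
    fix p assume p: "p \<in> ?J"
    let ?I = "genideal ?R (monomial ` G)"
    have G: "(monomial ` G :: 'k mpoly set) \<subseteq> carrier ?R"
      using assms by (auto simp: poly_ring_def)
    interpret I: ideal ?I ?R by (rule R.genideal_ideal[OF G])
    have single: "Poly_Mapping.single v (c :: 'k) \<in> ?I" if v: "v \<in> monomial_multiples n G" for v c
    proof -
      obtain g w where "v = g + w" "g \<in> G" "w \<in> monomials n"
        using v by (auto simp: monomial_multiples_def)
      moreover from this have "monomial g \<in> ?I" "Poly_Mapping.single w c \<in> carrier ?R"
        using R.genideal_self[OF G] by (auto simp: poly_ring_def)
      ultimately show ?thesis
        using I.I_r_closed[of "monomial g" "Poly_Mapping.single w c"]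
        by (simp add: poly_ring_def Poly_Mapping.mult_single)
    qed
    have "(\<Sum>v\<in>K. Poly_Mapping.single v (Poly_Mapping.lookup p v)) \<in> ?I"
      if "finite K" "K \<subseteq> monomial_multiples n G" for K
      using that
    proof (induction K)
      case empty
      then show ?case using I.zero_closed by (simp add: poly_ring_def)
    next
      case (insert v K)
      then show ?case
        using I.a_closed[OF single[of v]] by (simp add: poly_ring_def)
    qed
    from this[of "Poly_Mapping.keys p"] p show "p \<in> ?I"
      by (simp add: poly_mapping_sum_single)
  qed
qed

text \<open>The monomials with exponent in \<open>X\<close> form a basis. Independence is by
  induction: polynomials in the span of earlier monomials involve only those exponents, so the span
  misses a new monomial.\<close>

lemma dim_polys_with_keys:
  assumes "finite X"
  shows "vector_space.dim mscale {p :: 'k::field mpoly. Poly_Mapping.keys p \<subseteq> X} = card X"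
proof -
  interpret vector_space "mscale :: 'k \<Rightarrow> _" by (rule vector_space_mscale)
  have mscale: "mscale c (monomial v) = Poly_Mapping.single v c" for c :: 'k and v
    by (simp add: mscale_def Poly_Mapping.mult_single)
  have subspace: "subspace {p :: 'k mpoly. Poly_Mapping.keys p \<subseteq> Y}" for Y
  proof (rule subspaceI; clarsimp)
    show "u \<in> Y" if "Poly_Mapping.keys p \<subseteq> Y" "Poly_Mapping.keys q \<subseteq> Y"
      "u \<in> Poly_Mapping.keys (p + q)" for p q :: "'k mpoly" and u
      using that Poly_Mapping.keys_add[of p q] by blast
    show "u \<in> Y" if "Poly_Mapping.keys p \<subseteq> Y" "u \<in> Poly_Mapping.keys (mscale c p)"
      for p :: "'k mpoly" and u c
      using that keys_mult[of "Poly_Mapping.single 0 c" p]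
      by (auto simp: mscale_def split: if_splits)
  qed
  have inj: "inj_on (monomial :: pp \<Rightarrow> 'k mpoly) Y" for Y
    by (intro inj_onI) (metis keys_single one_neq_zero singleton_inject)
  have "independent (monomial ` Y :: 'k mpoly set)" if "finite Y" for Y
    using that
  proof (induction Y)
    case (insert v Y)
    have "span (monomial ` Y :: 'k mpoly set) \<subseteq> {p. Poly_Mapping.keys p \<subseteq> Y}"
      by (intro span_minimal subspace) auto
    moreover have "monomial v \<notin> {p :: 'k mpoly. Poly_Mapping.keys p \<subseteq> Y}"
      using insert.hyps by simp
    ultimately have "monomial v \<notin> span (monomial ` Y :: 'k mpoly set)"
      by (rule contra_subsetD)
    from independent_insertI[OF this insert.IH] show ?case by simp
  qed (simp add: independent_empty)
  moreover have "{p. Poly_Mapping.keys p \<subseteq> X} \<subseteq> span (monomial ` X :: 'k mpoly set)"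
  proof clarify
    fix p :: "'k mpoly" assume "Poly_Mapping.keys p \<subseteq> X"
    then have "(\<Sum>v\<in>Poly_Mapping.keys p. mscale (Poly_Mapping.lookup p v) (monomial v))
        \<in> span (monomial ` X :: 'k mpoly set)"
      by (intro span_sum span_scale span_base) auto
    then show "p \<in> span (monomial ` X)"
      by (simp add: mscale poly_mapping_sum_single)
  qed
  ultimately show ?thesis
    using assms by (intro dim_unique[of "monomial ` X"]) (auto simp: card_image inj)
qed

lemma finite_monomials_deg: "finite (monomials_deg n j)"
proof -
  have "finite (Poly_Mapping.lookup ` monomials_deg n j)"
  proof (rule finite_subset)
    show "Poly_Mapping.lookup ` monomials_deg n j
        \<subseteq> {f. \<forall>i. (i \<in> {1..n} \<longrightarrow> f i \<in> {..j}) \<and> (i \<notin> {1..n} \<longrightarrow> f i = 0)}"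
    proof clarsimp
      fix v i assume v: "v \<in> monomials_deg n j"
      have "Poly_Mapping.lookup v i \<le> j" if "i \<in> {1..n}"
        using v that member_le_sum[of i "{1..n}" "Poly_Mapping.lookup v"]
        by (auto simp: monomials_deg_def pdeg_eq_sum)
      then show "(Suc 0 \<le> i \<and> i \<le> n \<longrightarrow> Poly_Mapping.lookup v i \<le> j) \<and>
          ((Suc 0 \<le> i \<longrightarrow> \<not> i \<le> n) \<longrightarrow> Poly_Mapping.lookup v i = 0)"
        using v by (auto simp: monomials_deg_def in_monomials_iff)
    qed
    show "finite {f :: nat \<Rightarrow> nat. \<forall>i. (i \<in> {1..n} \<longrightarrow> f i \<in> {..j}) \<and> (i \<notin> {1..n} \<longrightarrow> f i = 0)}"
      by (rule finite_set_of_finite_funs) auto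
  qed
  then show ?thesis
    by (rule finite_imageD) (auto intro: inj_onI simp: lookup_inject)
qed

text \<open>The degree \<open>j\<close> part of a monomial ideal is cut out by a condition on
  exponents alone, so its dimension is a count of monomials.\<close>

lemma hilbert_fun_monomials:
  fixes G :: "pp set"
  assumes "G \<subseteq> monomials n"
  shows "hilbert_fun (genideal (poly_ring TYPE('k::field) n) (monomial ` G)) j =
    card (monomial_multiples n G \<inter> monomials_deg n j)"
proof -
  have sub: "monomial_multiples n G \<subseteq> monomials n"
    using assms by (auto simp: monomial_multiples_def)
  then have "homogeneous_part (genideal (poly_ring TYPE('k) n) (monomial ` G)) j =
      {p. Poly_Mapping.keys p \<subseteq> monomial_multiples n G \<inter> monomials_deg n j}"
    unfolding homogeneous_part_def genideal_monomials[OF assms]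
    by (auto simp: monomials_deg_def)
  then show ?thesis
    by (simp only: hilbert_fun_def dim_polys_with_keys[OF finite_Int[OF disjI2[OF finite_monomials_deg]]])
qed

section \<open>Initial segments of the lexicographic order\<close>

text \<open>The monomials above an element of \<open>T\<close> lie in \<open>T\<close> and omit that
  element, so there are fewer than \<open>card T\<close> of them; above a monomial outside
  \<open>T\<close> lies all of \<open>T\<close>, because the order is total.\<close>

lemma lexsegment_card_upset:
  assumes "T \<subseteq> monomials_deg n j"
    and up: "\<And>v w. v \<in> T \<Longrightarrow> w \<in> monomials_deg n j \<Longrightarrow> v < w \<Longrightarrow> w \<in> T"
  shows "lexsegment n j (card T) = T"
proof (intro equalityI subsetI)
  have fin: "finite T" using assms(1) finite_monomials_deg finite_subset by blast
  fix v
  {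
    assume v: "v \<in> T"
    then have "{w \<in> monomials_deg n j. v < w} \<subset> T"
      using up by auto
    then show "v \<in> lexsegment n j (card T)"
      using v assms(1) fin by (auto simp: lexsegment_def psubset_card_mono)
  }
  assume v: "v \<in> lexsegment n j (card T)"
  show "v \<in> T"
  proof (rule ccontr)
    assume "v \<notin> T"
    with v have "T \<subseteq> {w \<in> monomials_deg n j. v < w}"
      using up assms(1) by (auto simp: lexsegment_def) (metis neqE)
    then have "card T \<le> card {w \<in> monomials_deg n j. v < w}"
      by (intro card_mono) (auto simp: finite_monomials_deg)
    with v show False by (simp add: lexsegment_def)
  qed
qed

section \<open>The Borel ideal of \<open>x\<^sub>2\<^sup>d x\<^sub>5\<^sup>s\<close>\<close>

lemma atLeastAtMost_1_5: "{1..5::nat} = {1, 2, 3, 4, 5}"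
  by auto

lemma in_monomials_deg_5_iff:
  "v \<in> monomials_deg 5 j \<longleftrightarrow> v \<in> monomials 5 \<and>
    Poly_Mapping.lookup v 1 + Poly_Mapping.lookup v 2 + Poly_Mapping.lookup v 3
      + Poly_Mapping.lookup v 4 + Poly_Mapping.lookup v 5 = j"
  by (auto simp: monomials_deg_def pdeg_eq_sum atLeastAtMost_1_5 simp del: One_nat_def)

lemma monomial_5_expand:
  assumes "v \<in> monomials 5"
  shows "v = Poly_Mapping.single 1 (Poly_Mapping.lookup v 1) +
    Poly_Mapping.single 2 (Poly_Mapping.lookup v 2) +
    Poly_Mapping.single 3 (Poly_Mapping.lookup v 3) +
    Poly_Mapping.single 4 (Poly_Mapping.lookup v 4) +
    Poly_Mapping.single 5 (Poly_Mapping.lookup v 5)" (is "_ = ?w")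
proof (rule poly_mapping_eqI)
  fix i
  show "Poly_Mapping.lookup v i = Poly_Mapping.lookup ?w i"
  proof (cases "i \<in> {1..5}")
    case True
    then show ?thesis
      unfolding atLeastAtMost_1_5 by (auto simp: lookup_add lookup_single)
  next
    case False
    then have "Poly_Mapping.lookup v i = 0" "i \<notin> {1, 2, 3, 4, 5}"
      using assms by (auto simp: in_monomials_iff simp flip: atLeastAtMost_1_5)
    then show ?thesis by (simp add: lookup_add lookup_single)
  qed
qed

text \<open>This is \<open>k\<close> Borel moves in a row. Each move adds one factor
  \<open>pvar i\<close> to the fixed part, hence the induction over arbitrary
  \<open>w\<close>.\<close>

lemma borel_closure_shift:
  assumes "w + Poly_Mapping.single j k \<in> borel_closure u" "1 \<le> i" "i \<le> j"
  shows "w + Poly_Mapping.single i k \<in> borel_closure u"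
  using assms(1)
proof (induction k arbitrary: w)
  case 0
  then show ?case by simp
next
  case (Suc k)
  let ?v = "w + Poly_Mapping.single j (Suc k)"
  have "?v - pvar j + pvar i \<in> borel_closure u"
    using Suc.prems assms(2,3) by (intro borel_closure.step) (simp_all add: lookup_add)
  also have "?v - pvar j + pvar i = (w + pvar i) + Poly_Mapping.single j k"
    by (intro poly_mapping_eqI) (simp add: lookup_add lookup_minus lookup_single when_def)
  finally have "(w + pvar i) + Poly_Mapping.single i k \<in> borel_closure u"
    by (rule Suc.IH)
  also have "(w + pvar i) + Poly_Mapping.single i k = w + Poly_Mapping.single i (Suc k)"
    by (intro poly_mapping_eqI) (simp add: lookup_add lookup_single when_def)
  finally show ?case .
qed

text \<open>The monomials of degree \<open>j\<close> in the ideal (x1, x2)^d.\<close>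

definition ideal_part :: "nat \<Rightarrow> nat \<Rightarrow> pp set" where
  "ideal_part d j = {v \<in> monomials_deg 5 j. d \<le> Poly_Mapping.lookup v 1 + Poly_Mapping.lookup v 2}"

text \<open>A move never lowers the degree in x1, x2: if it removes one of these, then
  \<open>i \<le> j\<close> makes it insert one of them. Conversely, a given monomial is reached by
  moving factors x5 to x2, then x2 to x1, then the remaining x5 to x3 and x4 as required.\<close>

lemma borel_closure_eq:
  "borel_closure (Poly_Mapping.single 2 d + Poly_Mapping.single 5 s) = ideal_part d (d + s)"
  (is "borel_closure ?u = _")
proof (intro equalityI subsetI)
  fix v assume "v \<in> borel_closure ?u"
  then show "v \<in> ideal_part d (d + s)"
  proof induction
    case base
    then show ?case
      by (simp add: ideal_part_def monomials_deg_def lookup_add lookup_single)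
  next
    case (step v j i)
    let ?w = "v - pvar j"
    have mem: "pvar j + ?w \<in> monomials_deg 5 (d + s)"
      using step.IH by (simp add: ideal_part_def minus_pvar_add_pvar[OF step.hyps(2)] del: One_nat_def)
    then have "?w + pvar i \<in> monomials_deg 5 (d + s)"
      using step.hyps(3,4) by (simp add: monomials_deg_def)
    moreover have "d \<le> Poly_Mapping.lookup (pvar j + ?w) 1 + Poly_Mapping.lookup (pvar j + ?w) 2"
      using step.IH by (simp add: ideal_part_def minus_pvar_add_pvar[OF step.hyps(2)] del: One_nat_def)
    then have "d \<le> Poly_Mapping.lookup (?w + pvar i) 1 + Poly_Mapping.lookup (?w + pvar i) 2"
      using step.hyps(3,4) by (auto simp: lookup_add lookup_single when_def split: if_splits)
    ultimately show ?case by (simp add: ideal_part_def)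
  qed
next
  fix v assume "v \<in> ideal_part d (d + s)"
  define a b c e f where "a = Poly_Mapping.lookup v 1" "b = Poly_Mapping.lookup v 2"
    "c = Poly_Mapping.lookup v 3" "e = Poly_Mapping.lookup v 4" "f = Poly_Mapping.lookup v 5"
  note defs = this
  from \<open>v \<in> _\<close> have "v \<in> monomials 5" and sum: "a + b + c + e + f = d + s" and le: "d \<le> a + b"
    by (auto simp: ideal_part_def in_monomials_deg_5_iff defs)
  let ?x = "Poly_Mapping.single :: nat \<Rightarrow> nat \<Rightarrow> pp"
  from \<open>v \<in> monomials 5\<close> have v: "v = ?x 1 a + ?x 2 b + ?x 3 c + ?x 4 e + ?x 5 f"
    unfolding defs by (rule monomial_5_expand)
  \<comment> \<open>The excess of the degree in x1, x2 over \<open>d\<close>; it has to come from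
    factors x5.\<close>
  define k where "k = a + b - d"
  have s: "s = c + (e + (f + k))" and ab: "d + k = a + b" using sum le by (auto simp: k_def)
  have "?u = (?x 2 d + ?x 5 c + ?x 5 e + ?x 5 f) + ?x 5 k"
    unfolding s by (simp add: Poly_Mapping.single_add add_ac)
  then have "(?x 2 d + ?x 5 c + ?x 5 e + ?x 5 f) + ?x 5 k \<in> borel_closure ?u"
    by (metis borel_closure.base)
  then have "(?x 2 d + ?x 5 c + ?x 5 e + ?x 5 f) + ?x 2 k \<in> borel_closure ?u"
    by (rule borel_closure_shift) simp_all
  also have "(?x 2 d + ?x 5 c + ?x 5 e + ?x 5 f) + ?x 2 k = ?x 2 (d + k) + (?x 5 c + ?x 5 e + ?x 5 f)"
    by (simp only: Poly_Mapping.single_add add_ac)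
  also have "\<dots> = (?x 2 b + ?x 5 c + ?x 5 e + ?x 5 f) + ?x 2 a"
    by (simp only: ab Poly_Mapping.single_add add_ac)
  finally have "(?x 2 b + ?x 5 c + ?x 5 e + ?x 5 f) + ?x 2 a \<in> borel_closure ?u" .
  then have "(?x 2 b + ?x 5 c + ?x 5 e + ?x 5 f) + ?x 1 a \<in> borel_closure ?u"
    by (rule borel_closure_shift) simp_all
  then have "(?x 1 a + ?x 2 b + ?x 5 e + ?x 5 f) + ?x 5 c \<in> borel_closure ?u"
    by (simp only: add_ac)
  then have "(?x 1 a + ?x 2 b + ?x 5 e + ?x 5 f) + ?x 3 c \<in> borel_closure ?u"
    by (rule borel_closure_shift) simp_all
  then have "(?x 1 a + ?x 2 b + ?x 3 c + ?x 5 f) + ?x 5 e \<in> borel_closure ?u"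
    by (simp only: add_ac)
  then have "(?x 1 a + ?x 2 b + ?x 3 c + ?x 5 f) + ?x 4 e \<in> borel_closure ?u"
    by (rule borel_closure_shift) simp_all
  then show "v \<in> borel_closure ?u"
    unfolding v by (simp only: add_ac)
qed

text \<open>Induction on \<open>k\<close>: above degree \<open>d + s\<close> some variable can be
  divided out while the degree in x1, x2 stays at least \<open>d\<close>.\<close>

lemma ideal_part_subset_multiples:
  assumes "v \<in> ideal_part d (d + s + k)"
  shows "v \<in> monomial_multiples 5 (ideal_part d (d + s))"
  using assms
proof (induction k arbitrary: v)
  case 0
  then show ?case using subset_monomial_multiples by auto
next
  case (Suc k)
  have v: "v \<in> monomials_deg 5 (Suc (d + s + k))"
    "d \<le> Poly_Mapping.lookup v 1 + Poly_Mapping.lookup v 2"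
    using Suc.prems by (auto simp: ideal_part_def)
  \<comment> \<open>Any of x3, x4, x5 will do if it occurs; otherwise the degree in x1, x2 is the
    whole degree, which exceeds \<open>d\<close>.\<close>
  have "\<exists>i. Poly_Mapping.lookup v i > 0 \<and> (i \<in> {1, 2} \<longrightarrow>
      d < Poly_Mapping.lookup v 1 + Poly_Mapping.lookup v 2)"
  proof (cases "\<exists>i\<in>{3, 4, 5}. Poly_Mapping.lookup v i > 0")
    case False
    then have sum: "Poly_Mapping.lookup v 1 + Poly_Mapping.lookup v 2 = Suc (d + s + k)"
      using v(1) by (auto simp: in_monomials_deg_5_iff)
    then have "Poly_Mapping.lookup v 1 > 0 \<or> Poly_Mapping.lookup v 2 > 0" by auto
    with sum show ?thesis by auto
  qed auto
  then obtain i where i: "Poly_Mapping.lookup v i > 0"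
      "i \<in> {1, 2} \<Longrightarrow> d < Poly_Mapping.lookup v 1 + Poly_Mapping.lookup v 2" by blast
  obtain w where w: "w \<in> monomials_deg 5 (d + s + k)" "v = pvar i + w" "i \<in> {1..5}"
    by (rule divide_pvar[OF v(1) i(1)])
  then have "w \<in> ideal_part d (d + s + k)"
    using v(2) i(2) by (auto simp: ideal_part_def lookup_add lookup_single when_def split: if_splits)
  then obtain g u where "w = g + u" "g \<in> ideal_part d (d + s)" "u \<in> monomials 5"
    using Suc.IH unfolding monomial_multiples_def by blast
  with w have "v = g + (u + pvar i)" "u + pvar i \<in> monomials 5" "g \<in> ideal_part d (d + s)"
    by (auto simp: add_ac)
  then show ?case unfolding monomial_multiples_def by blast
qed

lemma monomial_multiples_ideal_part:
  assumes "d + s \<le> j"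
  shows "monomial_multiples 5 (ideal_part d (d + s)) \<inter> monomials_deg 5 j = ideal_part d j"
proof (intro equalityI subsetI)
  fix v assume "v \<in> monomial_multiples 5 (ideal_part d (d + s)) \<inter> monomials_deg 5 j"
  then show "v \<in> ideal_part d j"
    by (auto simp: monomial_multiples_def ideal_part_def lookup_add)
next
  fix v assume "v \<in> ideal_part d j"
  then show "v \<in> monomial_multiples 5 (ideal_part d (d + s)) \<inter> monomials_deg 5 j"
    using ideal_part_subset_multiples[of v d s "j - (d + s)"] assms by (auto simp: ideal_part_def)
qed

lemma hilbert_fun_borel_ideal:
  assumes "d + s \<le> j"
  shows "hilbert_fun (borel_ideal TYPE('k::field) 5
      (Poly_Mapping.single 2 d + Poly_Mapping.single 5 s)) j = card (ideal_part d j)"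
proof -
  have "ideal_part d (d + s) \<subseteq> monomials 5" by (auto simp: ideal_part_def monomials_deg_def)
  then show ?thesis
    unfolding borel_ideal_def borel_closure_eq
    by (simp add: hilbert_fun_monomials monomial_multiples_ideal_part[OF assms])
qed

section \<open>The Gotzmann condition in terms of cardinalities\<close>

text \<open>Macaulay's lower bound in five variables for the dimension in degree
  \<open>j + 1\<close>, given dimension \<open>k\<close> in degree \<open>j\<close>.\<close>

definition lexgrowth :: "nat \<Rightarrow> nat \<Rightarrow> nat" where
  "lexgrowth j k = card {pvar i + v | i v. i \<in> {1..5} \<and> v \<in> lexsegment 5 j k}"

text \<open>The definition allows any generating degree \<open>e\<close> and any set
  \<open>G\<close> of generators. From left to right it must be shown that
  \<open>e \<le> d + s\<close>, so that the condition covers all degrees from \<open>d + s\<close>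
  on.\<close>

lemma gotzmann_monomial_iff:
  "gotzmann_monomial TYPE('k::field) 5 (Poly_Mapping.single 2 d + Poly_Mapping.single 5 s) \<longleftrightarrow>
    (\<forall>j\<ge>d + s. card (ideal_part d (Suc j)) = lexgrowth j (card (ideal_part d j)))"
  (is "gotzmann_monomial _ _ ?u \<longleftrightarrow> ?R")
proof
  let ?I = "borel_ideal TYPE('k) 5 ?u"
  have sub: "ideal_part d (d + s) \<subseteq> monomials_deg 5 (d + s)" by (auto simp: ideal_part_def)
  {
    assume ?R
    then have "\<forall>j\<ge>d + s. hilbert_fun ?I (Suc j) =
        card {pvar i + v | i v. i \<in> {1..5} \<and> v \<in> lexsegment 5 j (hilbert_fun ?I j)}"
      by (simp add: hilbert_fun_borel_ideal lexgrowth_def del: One_nat_def)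
    moreover have "?I = genideal (poly_ring TYPE('k) 5) (monomial ` ideal_part d (d + s))"
      by (simp only: borel_ideal_def borel_closure_eq)
    moreover have "?u \<in> monomials 5" by simp
    ultimately show "gotzmann_monomial TYPE('k) 5 ?u"
      using sub unfolding gotzmann_monomial_def gotzmann_ideal_def by blast
  }
  assume "gotzmann_monomial TYPE('k) 5 ?u"
  then obtain e G where G: "G \<subseteq> monomials_deg 5 e"
    and I: "?I = genideal (poly_ring TYPE('k) 5) (monomial ` G)"
    and hf: "\<And>j. j \<ge> e \<Longrightarrow> hilbert_fun ?I (Suc j) = lexgrowth j (hilbert_fun ?I j)"
    unfolding gotzmann_monomial_def gotzmann_ideal_def lexgrowth_def by blast
  have "?u \<in> ideal_part d (d + s)"
    using borel_closure.base[of ?u] by (simp add: borel_closure_eq)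
  moreover have "ideal_part d (d + s) \<subseteq> monomials 5" "G \<subseteq> monomials 5"
    using G sub by (auto simp: monomials_deg_def)
  ultimately have "{p :: 'k mpoly. Poly_Mapping.keys p \<subseteq> monomial_multiples 5 (ideal_part d (d + s))}
      = {p. Poly_Mapping.keys p \<subseteq> monomial_multiples 5 G}"
    using I unfolding borel_ideal_def borel_closure_eq by (simp only: genideal_monomials)
  moreover have "(monomial ?u :: 'k mpoly)
      \<in> {p. Poly_Mapping.keys p \<subseteq> monomial_multiples 5 (ideal_part d (d + s))}"
    using \<open>?u \<in> ideal_part _ _\<close> subset_monomial_multiples[of "ideal_part d (d + s)" 5] by auto
  \<comment> \<open>The monomial \<open>?u\<close> of degree \<open>d + s\<close> lies in the ideal,
    so some generator of degree \<open>e\<close> divides it.\<close>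
  ultimately have "?u \<in> monomial_multiples 5 G" by auto
  then obtain g w where "?u = g + w" "g \<in> G"
    unfolding monomial_multiples_def by blast
  then have "pdeg ?u = e + pdeg w" using G by (auto simp: monomials_deg_def)
  then have "e \<le> d + s" by simp
  then show ?R
  proof (intro allI impI)
    fix j assume "e \<le> d + s" "d + s \<le> j"
    then show "card (ideal_part d (Suc j)) = lexgrowth j (card (ideal_part d j))"
      using hf[of j] by (simp add: hilbert_fun_borel_ideal[where ?'k = 'k] del: One_nat_def)
  qed
qed

section \<open>Growth of lexicographic segments\<close>

text \<open>The exponents of \<open>x\<^sub>1, \<dots>, x\<^sub>4\<close> are compared with \<open>(0, A, b, c)\<close>; the exponent of
  \<open>x\<^sub>5\<close> is then determined by the degree.\<close>

definition lex_ge :: "nat \<Rightarrow> nat \<Rightarrow> nat \<Rightarrow> nat \<Rightarrow> nat \<Rightarrow> nat \<Rightarrow> nat \<Rightarrow> bool" where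
  "lex_ge A b c p q r t \<longleftrightarrow> 0 < p \<or> A < q \<or> q = A \<and> (b < r \<or> r = b \<and> c \<le> t)"

text \<open>The monomials of degree \<open>j\<close> in the lexicographic ideal (x1, x2^(A+1), x2^A
  x3^(b+1), x2^A x3^b x4^c).\<close>

definition lex_part :: "nat \<Rightarrow> nat \<Rightarrow> nat \<Rightarrow> nat \<Rightarrow> pp set" where
  "lex_part A b c j = {v \<in> monomials_deg 5 j. lex_ge A b c (Poly_Mapping.lookup v 1)
     (Poly_Mapping.lookup v 2) (Poly_Mapping.lookup v 3) (Poly_Mapping.lookup v 4)}"

lemma lexsegment_lex_part: "lexsegment 5 j (card (lex_part A b c j)) = lex_part A b c j"
proof (rule lexsegment_card_upset)
  show "lex_part A b c j \<subseteq> monomials_deg 5 j" by (auto simp: lex_part_def)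
  fix v w assume v: "v \<in> lex_part A b c j" and w: "w \<in> monomials_deg 5 j" and "v < w"
  then obtain k where k: "Poly_Mapping.lookup v k < Poly_Mapping.lookup w k"
      "\<And>i. i < k \<Longrightarrow> Poly_Mapping.lookup v i = Poly_Mapping.lookup w i"
    by (auto simp: less_poly_mapping.rep_eq less_fun_def)
  have "k \<in> {1..5}"
  proof (rule ccontr)
    assume "k \<notin> {1..5}"
    with w have "Poly_Mapping.lookup w k = 0" by (simp add: monomials_deg_def in_monomials_iff)
    with k(1) show False by simp
  qed
  \<comment> \<open>For \<open>k = 5\<close> the first four exponents agree, and
    \<open>lex_ge\<close> sees only these.\<close>
  then consider "k = 1" | "k = 2" | "k = 3" | "k = 4" | "k = 5"
    unfolding atLeastAtMost_1_5 by (elim insertE) auto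
  then have "lex_ge A b c (Poly_Mapping.lookup w 1) (Poly_Mapping.lookup w 2)
      (Poly_Mapping.lookup w 3) (Poly_Mapping.lookup w 4)"
    using v k(1) k(2)[of 1] k(2)[of 2] k(2)[of 3] k(2)[of 4]
    unfolding lex_part_def lex_ge_def by cases auto
  with w show "w \<in> lex_part A b c j" by (simp add: lex_part_def)
qed

text \<open>Since \<open>0 < c\<close>, all generators of the lexicographic ideal have degree at
  most \<open>A + b + c\<close>. In larger degree the last variable that occurs can be divided out:
  either it does not matter for the comparison, or the degree forces its exponent above the required
  value.\<close>

lemma lex_ge_divide:
  assumes "lex_ge A b c p q r t" "p + q + r + t + u = Suc j" "A + b + c \<le> j" "0 < c"
  shows "0 < p \<and> lex_ge A b c (p - 1) q r t \<or> 0 < q \<and> lex_ge A b c p (q - 1) r t \<or>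
    0 < r \<and> lex_ge A b c p q (r - 1) t \<or> 0 < t \<and> lex_ge A b c p q r (t - 1) \<or>
    0 < u \<and> lex_ge A b c p q r t"
proof -
  consider "0 < u" | "u = 0" "0 < t" | "u = 0" "t = 0" "0 < r" | "u = 0" "t = 0" "r = 0" "0 < q"
    | "u = 0" "t = 0" "r = 0" "q = 0" by blast
  then show ?thesis
    using assms unfolding lex_ge_def by cases auto
qed

lemma lex_part_growth:
  assumes "A + b + c \<le> j" "0 < c"
  shows "{pvar i + v | i v. i \<in> {1..5} \<and> v \<in> lex_part A b c j} = lex_part A b c (Suc j)"
proof (intro equalityI subsetI)
  fix x assume "x \<in> {pvar i + v | i v. i \<in> {1..5} \<and> v \<in> lex_part A b c j}"
  then show "x \<in> lex_part A b c (Suc j)"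
    by (auto simp: lex_part_def monomials_deg_def lex_ge_def lookup_add lookup_single when_def)
next
  fix v assume v: "v \<in> lex_part A b c (Suc j)"
  let ?P = "\<lambda>v. lex_ge A b c (Poly_Mapping.lookup v 1) (Poly_Mapping.lookup v 2)
    (Poly_Mapping.lookup v 3) (Poly_Mapping.lookup v 4)"
  have deg: "v \<in> monomials_deg 5 (Suc j)" using v by (simp add: lex_part_def)
  \<comment> \<open>Written with \<open>1 when i = k\<close> so that the five choices of
    \<open>i\<close> match the five disjuncts of \<open>lex_ge_divide\<close>; \<open>i = 5\<close>
    leaves all compared exponents unchanged.\<close>
  have P: "?P (v - pvar i) = lex_ge A b c
      (Poly_Mapping.lookup v 1 - (1 when i = 1)) (Poly_Mapping.lookup v 2 - (1 when i = 2))
      (Poly_Mapping.lookup v 3 - (1 when i = 3)) (Poly_Mapping.lookup v 4 - (1 when i = 4))" for i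
    by (simp only: lookup_minus lookup_single)
  have "\<exists>i\<in>{1, 2, 3, 4, 5}. 0 < Poly_Mapping.lookup v i \<and> ?P (v - pvar i)"
    using lex_ge_divide[of A b c "Poly_Mapping.lookup v 1" "Poly_Mapping.lookup v 2"
        "Poly_Mapping.lookup v 3" "Poly_Mapping.lookup v 4" "Poly_Mapping.lookup v 5" j] v assms
    unfolding lex_part_def in_monomials_deg_5_iff mem_Collect_eq P by simp
  then obtain i where i: "0 < Poly_Mapping.lookup v i" "?P (v - pvar i)" by blast
  obtain w where w: "w \<in> monomials_deg 5 j" "v = pvar i + w" "i \<in> {1..5}"
    by (rule divide_pvar[OF deg i(1)])
  then have "w \<in> lex_part A b c j" using i(2) by (simp add: lex_part_def)
  with w show "v \<in> {pvar i + v | i v. i \<in> {1..5} \<and> v \<in> lex_part A b c j}" by blast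
qed

lemma finite_lex_part: "finite (lex_part A b c j)"
  by (rule finite_subset[OF _ finite_monomials_deg[of 5 j]]) (auto simp: lex_part_def)

lemma lexgrowth_lex_part:
  assumes "A + b + c \<le> j" "0 < c"
  shows "lexgrowth j (card (lex_part A b c j)) = card (lex_part A b c (Suc j))"
  by (simp only: lexgrowth_def lexsegment_lex_part lex_part_growth[OF assms])

text \<open>In degree \<open>A + b + c - 1\<close> no multiple of \<open>x\<^sub>2\<^sup>A x\<^sub>3\<^sup>b x\<^sub>4\<^sup>c\<close> exists yet, so the growth of
  the segment misses this monomial.\<close>

lemma lexgrowth_lex_part_less:
  assumes "Suc j = A + b + c"
  shows "lexgrowth j (card (lex_part A b c j)) < card (lex_part A b c (Suc j))"
proof -
  let ?S = "{pvar i + v | i v. i \<in> {1..5} \<and> v \<in> lex_part A b c j}"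
  let ?m = "Poly_Mapping.single 2 A + Poly_Mapping.single 3 b + Poly_Mapping.single 4 c :: pp"
  have "?m \<in> lex_part A b c (Suc j)"
    using assms by (simp add: lex_part_def monomials_deg_def lex_ge_def lookup_add lookup_single)
  moreover have "?m \<notin> ?S"
  proof
    assume "?m \<in> ?S"
    then obtain i v where m: "?m = pvar i + v" "i \<in> {1..5}" and v: "v \<in> lex_part A b c j"
      by blast
    have eq: "Poly_Mapping.lookup ?m k = Poly_Mapping.lookup (pvar i) k + Poly_Mapping.lookup v k" for k
      by (simp only: m(1) lookup_add)
    \<comment> \<open>Comparing exponents leaves only \<open>i\<close> = 2, 3 or 4, and the quotient
      \<open>v\<close> then falls short of \<open>(0, A, b, c)\<close> in that position.\<close>
    show False
      using eq[of 1] eq[of 2] eq[of 3] eq[of 4] eq[of 5] v m(2)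
      unfolding lex_part_def in_monomials_deg_5_iff lex_ge_def atLeastAtMost_1_5
      by (auto simp: lookup_add lookup_single)
  qed
  moreover have "?S \<subseteq> lex_part A b c (Suc j)"
    by (auto simp: lex_part_def monomials_deg_def lex_ge_def lookup_add lookup_single when_def)
  ultimately have "?S \<subset> lex_part A b c (Suc j)" by blast
  then show ?thesis
    by (simp only: lexgrowth_def lexsegment_lex_part psubset_card_mono[OF finite_lex_part])
qed

section \<open>Counting monomials\<close>

text \<open>The exponent of x5 is the slack that turns the degree equation into an
  inequality.\<close>

lemma card_monomials_deg_5:
  "card {v \<in> monomials_deg 5 j. Q (Poly_Mapping.lookup v 1) (Poly_Mapping.lookup v 2)
      (Poly_Mapping.lookup v 3) (Poly_Mapping.lookup v 4)} =
    card {(p, q, r, t). p + q + r + t \<le> j \<and> Q p q r t}"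
proof (rule bij_betw_same_card)
  let ?x = "Poly_Mapping.single :: nat \<Rightarrow> nat \<Rightarrow> pp"
  let ?f = "\<lambda>v. (Poly_Mapping.lookup v 1, Poly_Mapping.lookup v 2,
    Poly_Mapping.lookup v 3, Poly_Mapping.lookup v 4)"
  let ?g = "\<lambda>(p, q, r, t). ?x 1 p + ?x 2 q + ?x 3 r + ?x 4 t + ?x 5 (j - (p + q + r + t))"
  show "bij_betw ?f {v \<in> monomials_deg 5 j. Q (Poly_Mapping.lookup v 1) (Poly_Mapping.lookup v 2)
      (Poly_Mapping.lookup v 3) (Poly_Mapping.lookup v 4)}
    {(p, q, r, t). p + q + r + t \<le> j \<and> Q p q r t}"
  proof (rule bij_betw_byWitness[where f' = ?g])
    show "\<forall>v\<in>{v \<in> monomials_deg 5 j. Q (Poly_Mapping.lookup v 1) (Poly_Mapping.lookup v 2)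
      (Poly_Mapping.lookup v 3) (Poly_Mapping.lookup v 4)}. ?g (?f v) = v"
    proof
      fix v assume "v \<in> {v \<in> monomials_deg 5 j. Q (Poly_Mapping.lookup v 1) (Poly_Mapping.lookup v 2)
        (Poly_Mapping.lookup v 3) (Poly_Mapping.lookup v 4)}"
      then have v: "v \<in> monomials 5" and "Poly_Mapping.lookup v 5 = j - (Poly_Mapping.lookup v 1 +
          Poly_Mapping.lookup v 2 + Poly_Mapping.lookup v 3 + Poly_Mapping.lookup v 4)"
        by (auto simp: in_monomials_deg_5_iff)
      then show "?g (?f v) = v"
        using monomial_5_expand[OF v] by (simp del: One_nat_def)
    qed
  qed (auto simp: in_monomials_deg_5_iff lookup_add lookup_single)
qed

text \<open>Allows the two ideals to be compared through their complements, which are the sets that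
  are counted below.\<close>

lemma card_Collect_not:
  assumes "finite X" "card {x \<in> X. \<not> P x} = card {x \<in> X. \<not> Q x}"
  shows "card {x \<in> X. P x} = card {x \<in> X. Q x}"
proof -
  have *: "card {x \<in> X. R x} = card X - card {x \<in> X. \<not> R x}" for R
  proof -
    have "{x \<in> X. R x} = X - {x \<in> X. \<not> R x}" by auto
    then show ?thesis using assms(1) by (simp add: card_Diff_subset)
  qed
  show ?thesis unfolding *[of P] *[of Q] assms(2) ..
qed

lemma sum_linear:
  fixes y :: real
  shows "(\<Sum>q<k. y - real q + 1) = real k * (2 * y + 3 - real k) / 2"
  by (induction k) (simp_all add: field_simps)

lemma real_card_pairs_le: "real (card {(q, r). q + r \<le> m}) = (real m + 2) * (real m + 1) / 2"
proof -
  have "{(q, r). q + r \<le> m} = (SIGMA q:{..<Suc m}. {..m - q})" by auto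
  then have "real (card {(q, r). q + r \<le> m}) = (\<Sum>q<Suc m. real (Suc (m - q)))"
    by simp
  also have "\<dots> = (\<Sum>q<Suc m. real m - real q + 1)"
    by (intro sum.cong) auto
  also have "\<dots> = (real m + 2) * (real m + 1) / 2"
    unfolding sum_linear by (simp add: field_simps)
  finally show ?thesis .
qed

lemma finite_pairs_le: "finite {(q, r). q + r \<le> (m :: nat)}"
  by (rule finite_subset[of _ "{..m} \<times> {..m}"]) auto

lemma sum_weighted_quadratic:
  fixes y :: real
  shows "(\<Sum>k<d. real (Suc k) * ((y - k + 2) * (y - k + 1) / 2)) =
    d * (d + 1) * (y\<^sup>2 + 3 * y + 2) / 4 - (2 * y + 3) * (real d - 1) * d * (d + 1) / 6
    + (real d)\<^sup>2 * (real d - 1)\<^sup>2 / 8 + (real d - 1) * d * (2 * real d - 1) / 12"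
  by (induction d) (simp_all add: field_simps power2_eq_square)

text \<open>The sum telescopes: each summand is the difference of the values of z(z-1)(z-2)/6 at z =
  y - p + 3 and at z = y - p + 2.\<close>

lemma sum_quadratic:
  fixes y :: real
  shows "(\<Sum>p<A. (y - real p + 2) * (y - real p + 1) / 2) =
    ((y + 3) * (y + 2) * (y + 1) - (y + 3 - A) * (y + 2 - A) * (y + 1 - A)) / 6"
  by (induction A) (simp_all add: field_simps)

text \<open>Sort by \<open>k = p + q\<close>, which leaves \<open>Suc k\<close> choices for
  \<open>p\<close>. The assumption gives \<open>k \<le> j\<close>, so that \<open>j - k\<close> is
  not truncated.\<close>

lemma card_not_ideal_part:
  assumes "d \<le> Suc j"
  shows "real (card {(p, q, r, t). p + q + r + t \<le> j \<and> \<not> d \<le> p + q}) =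
    (\<Sum>k<d. real (Suc k) * ((real j - k + 2) * (real j - k + 1) / 2))"
proof -
  let ?X = "SIGMA k:{..<d}. {..k} \<times> {(r, t). r + t \<le> j - k}"
  have "bij_betw (\<lambda>(k, p, r, t). (p, k - p, r, t)) ?X
      {(p, q, r, t). p + q + r + t \<le> j \<and> \<not> d \<le> p + q}"
    using assms
    by (intro bij_betw_byWitness[where f' = "\<lambda>(p, q, r, t). (p + q, p, r, t)"]) auto
  then have "card {(p, q, r, t). p + q + r + t \<le> j \<and> \<not> d \<le> p + q} = card ?X"
    by (rule bij_betw_same_card[symmetric])
  also have "real \<dots> = (\<Sum>k<d. real (Suc k) * real (card {(r, t). r + t \<le> j - k}))"
    by (simp add: finite_pairs_le card_cartesian_product algebra_simps)
  also have "\<dots> = (\<Sum>k<d. real (Suc k) * ((real j - k + 2) * (real j - k + 1) / 2))"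
    using assms by (intro sum.cong) (auto simp: real_card_pairs_le of_nat_diff)
  finally show ?thesis .
qed

text \<open>The complement has \<open>p = 0\<close> and splits into \<open>q < A\<close>, then
  \<open>q = A\<close> with \<open>r < b\<close>, then \<open>q = A\<close>, \<open>r = b\<close>
  with \<open>t < c\<close>. The bound \<open>Suc j\<close> admits degree
  \<open>A + b + c - 1\<close>, where all \<open>c\<close> monomials of the last kind still
  fit.\<close>

lemma card_not_lex_part:
  assumes "A + b + c \<le> Suc j" "0 < c"
  shows "real (card {(p, q, r, t). p + q + r + t \<le> j \<and> \<not> lex_ge A b c p q r t}) =
    (\<Sum>p<A. (real j - real p + 2) * (real j - real p + 1) / 2)
    + (\<Sum>q<b. (real j - A) - real q + 1) + real c"
proof -
  let ?X = "SIGMA q:{..<A}. {(r, t). r + t \<le> j - q}"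
  let ?Y = "SIGMA r:{..<b}. {..j - A - r}"
  let ?f = "\<lambda>(q, r, t). (0 :: nat, q, r, t)"
  let ?g = "\<lambda>(r, t). (0 :: nat, A, r, t)" and ?h = "\<lambda>t. (0 :: nat, A, b, t)"
  have eq: "{(p, q, r, t). p + q + r + t \<le> j \<and> \<not> lex_ge A b c p q r t} =
      ?f ` ?X \<union> (?g ` ?Y \<union> ?h ` {..<c})"
    using assms by (auto simp: lex_ge_def image_iff)
  have "card {(p, q, r, t). p + q + r + t \<le> j \<and> \<not> lex_ge A b c p q r t} =
      card ?X + (card ?Y + c)"
    unfolding eq
  proof (subst card_Un_disjoint)
    show "finite (?f ` ?X)" by (auto intro!: finite_imageI finite_SigmaI finite_pairs_le)
    show "?f ` ?X \<inter> (?g ` ?Y \<union> ?h ` {..<c}) = {}" by auto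
    have "card (?f ` ?X) = card ?X" "card (?g ` ?Y) = card ?Y" "card (?h ` {..<c}) = c"
      by (subst card_image; auto intro!: inj_onI)+
    moreover have "card (?g ` ?Y \<union> ?h ` {..<c}) = card (?g ` ?Y) + card (?h ` {..<c})"
      by (intro card_Un_disjoint) auto
    ultimately show "card (?f ` ?X) + card (?g ` ?Y \<union> ?h ` {..<c}) = card ?X + (card ?Y + c)"
      by simp
  qed auto
  then have "real (card {(p, q, r, t). p + q + r + t \<le> j \<and> \<not> lex_ge A b c p q r t}) =
      (\<Sum>q<A. real (card {(r, t). r + t \<le> j - q}))
      + (\<Sum>r<b. real (Suc (j - A - r))) + real c"
    by (simp add: finite_pairs_le)
  also have "(\<Sum>q<A. real (card {(r, t). r + t \<le> j - q})) =
      (\<Sum>p<A. (real j - real p + 2) * (real j - real p + 1) / 2)"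
    using assms by (intro sum.cong) (auto simp: real_card_pairs_le of_nat_diff)
  also have "(\<Sum>r<b. real (Suc (j - A - r))) = (\<Sum>q<b. (real j - A) - real q + 1)"
    using assms by (intro sum.cong) (auto simp: of_nat_diff)
  finally show ?thesis .
qed

section \<open>The Gotzmann number\<close>

lemma real_choose_2: "real (n choose 2) = real n * (real n - 1) / 2"
  by (induction n) (simp_all add: numeral_2_eq_2 field_simps)

lemma real_choose_3: "real (n choose 3) = real n * (real n - 1) * (real n - 2) / 6"
proof (induction n)
  case (Suc n)
  have "Suc n choose 3 = (n choose 2) + (n choose 3)"
    by (simp add: numeral_3_eq_3 numeral_2_eq_2)
  then show ?case using Suc by (simp add: real_choose_2 field_simps)
qed simp

lemma real_choose_4: "real (n choose 4) = real n * (real n - 1) * (real n - 2) * (real n - 3) / 24"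
proof (induction n)
  case (Suc n)
  have "Suc n choose 4 = (n choose 3) + (n choose 4)"
    by (simp add: eval_nat_numeral)
  then show ?case using Suc by (simp add: real_choose_3 field_simps)
qed simp

text \<open>Both sides are Hilbert polynomials at \<open>y\<close>: of the quotient by \<open>(x\<^sub>1, x\<^sub>2)\<^sup>d\<close> and of the
  quotient by the lexicographic ideal. The computation is done modulo \<open>d\<^sup>2 = 2m + d\<close>, and the
  factor 72 clears all denominators.\<close>

lemma hilbert_polynomial_identity:
  fixes d y A b c m :: real
  assumes m: "m = d * (d - 1) / 2" and A: "A = m + d"
    and b: "b = m * (m - 1) / 2 + (d + 1) * d * (d - 1) / 6"
    and c: "c = (b + m) * (b + m - 1) / 2 + (d + 3) * (d + 2) * (d + 1) * d / 24
      - m * (m - 1) * (m - 2) / 6 - A - b"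
  shows "d * (d + 1) * (y\<^sup>2 + 3 * y + 2) / 4 - (2 * y + 3) * (d - 1) * d * (d + 1) / 6
      + d\<^sup>2 * (d - 1)\<^sup>2 / 8 + (d - 1) * d * (2 * d - 1) / 12 =
    ((y + 3) * (y + 2) * (y + 1) - (y + 3 - A) * (y + 2 - A) * (y + 1 - A)) / 6
      + b * (2 * (y - A) + 3 - b) / 2 + c"
proof -
  have d2: "d * d = 2 * m + d" using m by (simp add: field_simps)
  have d2': "d * (d * z) = 2 * (m * z) + d * z" for z
    by (simp add: d2 distrib_right flip: mult.assoc)
  note reduce = algebra_simps d2 d2' power2_eq_square
  have b': "6 * b = m * (3 * m + 2 * d - 1)"
    unfolding b by (simp add: reduce add_divide_distrib diff_divide_distrib)
  \<comment> \<open>This is \<open>6 * b\<close>; the factor 72 then turns the term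
    \<open>b * b / 2\<close> into \<open>k * k\<close>.\<close>
  define k where "k = m * (3 * m + 2 * d - 1)"
  have b: "b = k / 6" using b' by (simp add: k_def)
  \<comment> \<open>The bracket \<open>12 * (m * m + 4 * m * d + 9 * m + 6 * d)\<close> is the
    reduced form of \<open>3 * (d + 3) * (d + 2) * (d + 1) * d\<close>.\<close>
  have c': "72 * c = k * k + 12 * k * m - 6 * k + 36 * m * m - 36 * m + 12 * (m * m + 4 * m * d + 9 * m + 6 * d)
    - 12 * m * (m - 1) * (m - 2) - 72 * A - 12 * k"
    unfolding b c by (simp add: reduce add_divide_distrib diff_divide_distrib)
  have 1: "d * (d + 1) = 2 * (m + d)" "(d - 1) * d * (d + 1) = 2 * m * (d + 1)"
    "(d - 1) * d * (2 * d - 1) = 2 * m * (2 * d - 1)" "d\<^sup>2 * (d - 1)\<^sup>2 = 4 * m * m"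
    by (simp_all add: reduce)
  have "72 * (d * (d + 1) * (y\<^sup>2 + 3 * y + 2) / 4 - (2 * y + 3) * (d - 1) * d * (d + 1) / 6
      + d\<^sup>2 * (d - 1)\<^sup>2 / 8 + (d - 1) * d * (2 * d - 1) / 12) =
    18 * (2 * (m + d) * (y\<^sup>2 + 3 * y + 2)) - 12 * ((2 * y + 3) * (2 * m * (d + 1)))
      + 9 * (4 * m * m) + 6 * (2 * m * (2 * d - 1))"
    unfolding 1[symmetric] by (simp add: field_simps power2_eq_square)
  also have "\<dots> = 12 * ((y + 3) * (y + 2) * (y + 1) - (y + 3 - A) * (y + 2 - A) * (y + 1 - A))
      + k * (12 * (y - A) + 18 - k) + 72 * c"
    unfolding c' A k_def by (simp add: reduce)
  also have "\<dots> = 72 * (((y + 3) * (y + 2) * (y + 1) - (y + 3 - A) * (y + 2 - A) * (y + 1 - A)) / 6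
      + b * (2 * (y - A) + 3 - b) / 2 + c)"
    unfolding b by (simp add: field_simps)
  finally show ?thesis by (rule mult_left_cancel[THEN iffD1, rotated]) simp
qed

text \<open>Says that \<open>c > 0\<close>, without which the growth would not fail in degree \<open>A + b + c - 1\<close>.\<close>

lemma gotzmann_number_ge:
  fixes d :: nat
  assumes "2 \<le> d"
  defines "m \<equiv> d choose 2"
  defines "B \<equiv> (m choose 2) + ((d + 1) choose 3) + m"
  shows "(m choose 3) + B + d + 1 \<le> (B choose 2) + ((d + 3) choose 4)"
proof -
  have "0 < m" "0 < (d + 1) choose 3"
    using assms(1) unfolding m_def by (intro zero_less_binomial; simp)+
  then have m: "1 \<le> real m" and "1 \<le> real ((d + 1) choose 3)"
    by linarith+
  then have B: "real m * (real m - 1) / 2 + real m + 1 \<le> real B"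
    unfolding B_def of_nat_add real_choose_2 by linarith
  have "24 \<le> (d + 2) * (d + 1) * d"
    using mult_le_mono[OF mult_le_mono[of 4 "d + 2" 3 "d + 1"] assms(1)] assms(1) by simp
  then have "24 \<le> (real d + 2) * (real d + 1) * real d"
    by (metis (mono_tags) of_nat_le_iff of_nat_mult of_nat_add of_nat_numeral of_nat_1)
  then have "(real d + 3) * 24 \<le> (real d + 3) * ((real d + 2) * (real d + 1) * real d)"
    by (intro mult_left_mono) auto
  then have d4: "real d + 3 \<le> real ((d + 3) choose 4)"
    by (simp add: real_choose_4 field_simps)
  \<comment> \<open>A lower bound for \<open>B\<close> in terms of \<open>m\<close> alone, with the
    middle binomial coefficient replaced by 1. Since \<open>(B choose 2) - B\<close> is
    \<open>B * (B - 3) / 2\<close>, the product below expresses that this quantity increases from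
    \<open>B'\<close> to \<open>B\<close>.\<close>
  define B' where "B' = real m * (real m - 1) / 2 + real m + 1"
  have "0 \<le> (real B - B') * (real B + B' - 3)"
  proof (intro mult_nonneg_nonneg)
    have "0 \<le> real m * (real m - 1)" using m by simp
    then have "2 \<le> B'" using m unfolding B'_def by linarith
    then show "0 \<le> real B + B' - 3" "0 \<le> real B - B'" using B by (simp_all add: B'_def)
  qed
  then have "B' * (B' - 3) / 2 \<le> real B * (real B - 3) / 2"
    by (simp add: field_simps)
  moreover have "real m * (real m - 1) * (real m - 2) / 6 \<le> B' * (B' - 3) / 2 + 2"
  proof -
    \<comment> \<open>Every term of the polynomial on the right is visibly nonnegative for natural
      \<open>m\<close>.\<close>
    have "24 * (B' * (B' - 3) / 2 + 2 - real m * (real m - 1) * (real m - 2) / 6) =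
        3 * real m ^ 4 + 2 * real m ^ 3 + (3 * real m - 7 / 3)\<^sup>2 + 167 / 9"
      unfolding B'_def
      by (simp add: field_simps power2_eq_square power3_eq_cube power4_eq_xxxx)
    also have "\<dots> \<ge> 0" by simp
    finally show ?thesis by simp
  qed
  ultimately have "real (m choose 3) + real B \<le> real (B choose 2) + 2"
    unfolding real_choose_2 real_choose_3 by (simp add: field_simps)
  \<comment> \<open>The surplus 2 in the bound for \<open>B\<close> is absorbed by the gap between
    \<open>d + 1\<close> and \<open>d + 3\<close>.\<close>
  with d4 have "real ((m choose 3) + B + d + 1) \<le> real ((B choose 2) + ((d + 3) choose 4))"
    by simp
  then show ?thesis by (simp only: of_nat_le_iff)
qed

section \<open>Determination of the threshold\<close>

text \<open>A threshold is the least \<open>s\<close> with the property, hence unique; existence is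
  supplied by the explicit \<open>t\<close>.\<close>

lemma gotzmann_threshold_eqI:
  assumes "\<And>s. gotzmann_monomial K n (u + Poly_Mapping.single n s) \<longleftrightarrow> t \<le> s"
  shows "gotzmann_threshold K n u = t"
  unfolding gotzmann_threshold_def
proof (rule the_equality)
  fix t' assume "\<forall>s. gotzmann_monomial K n (u + Poly_Mapping.single n s) \<longleftrightarrow> t' \<le> s"
  then have "t \<le> s \<longleftrightarrow> t' \<le> s" for s using assms by simp
  from this[of t] this[of t'] show "t' = t" by simp
qed (use assms in simp)

theorem theorem5p2:
  fixes d :: nat
  assumes "d \<ge> 2"
  shows "int (gotzmann_threshold TYPE('k::field) 5 (Poly_Mapping.single 2 d)) =
    int ((((d choose 2) choose 2) + ((d + 1) choose 3) + (d choose 2)) choose 2)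
    - int ((d choose 2) choose 3) + int ((d + 3) choose 4) - int d"
proof -
  \<comment> \<open>Comparing the coefficients of y^2, y and 1 in the two Hilbert polynomials
    determines \<open>A\<close>, then \<open>b\<close>, then \<open>c\<close>; here \<open>A\<close>
    equals \<open>(d + 1) choose 2\<close>, and \<open>N\<close> is
    \<open>A + b + c\<close>.\<close>
  define m where "m = d choose 2"
  define b where "b = (m choose 2) + ((d + 1) choose 3)"
  define A where "A = m + d"
  define N where "N = ((b + m) choose 2) + ((d + 3) choose 4) - (m choose 3)"
  define c where "c = N - (A + b)"
  \<comment> \<open>Makes the natural subtractions in \<open>N\<close>, \<open>c\<close> and
    \<open>N - d\<close> exact, and \<open>c\<close> positive.\<close>
  have ge: "(m choose 3) + (b + m) + d + 1 \<le> ((b + m) choose 2) + ((d + 3) choose 4)"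
    using gotzmann_number_ge[OF assms] unfolding b_def m_def .
  have N: "N = A + b + c" and c: "0 < c"
    using ge by (auto simp: c_def N_def A_def)
  have rm: "real m = real d * (real d - 1) / 2" and rA: "real A = real m + real d"
    and rb: "real b = real m * (real m - 1) / 2 + (real d + 1) * real d * (real d - 1) / 6"
    by (simp_all add: m_def A_def b_def real_choose_2 real_choose_3)
  have "real c + real A + real b + real (m choose 3) = real (((b + m) choose 2) + ((d + 3) choose 4))"
    using ge unfolding c_def N_def A_def by (simp flip: of_nat_add)
  then have rc: "real c = (real b + real m) * (real b + real m - 1) / 2
      + (real d + 3) * (real d + 2) * (real d + 1) * real d / 24
      - real m * (real m - 1) * (real m - 2) / 6 - real A - real b"
    by (simp add: real_choose_2 real_choose_3 real_choose_4 field_simps)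
  \<comment> \<open>Degree \<open>N - 1\<close> is included because the failure of minimal growth
    from \<open>N - 1\<close> to \<open>N\<close> is transferred through equal counts in both
    degrees.\<close>
  have card_eq: "card (ideal_part d j) = card (lex_part A b c j)" if "N \<le> Suc j" for j
  proof -
    have "d \<le> Suc j" "A + b + c \<le> Suc j"
      using that unfolding N by (simp_all add: A_def)
    then have "real (card {(p, q, r, t). p + q + r + t \<le> j \<and> \<not> d \<le> p + q}) =
        real (card {(p, q, r, t). p + q + r + t \<le> j \<and> \<not> lex_ge A b c p q r t})"
      by (simp only: card_not_ideal_part card_not_lex_part[OF _ c] sum_weighted_quadratic sum_quadratic sum_linear
          hilbert_polynomial_identity[OF rm rA rb rc])
    then have "card {(p, q, r, t). p + q + r + t \<le> j \<and> \<not> d \<le> p + q} =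
        card {(p, q, r, t). p + q + r + t \<le> j \<and> \<not> lex_ge A b c p q r t}"
      by (simp only: of_nat_eq_iff)
    then have "card {v \<in> monomials_deg 5 j. \<not> d \<le> Poly_Mapping.lookup v 1 + Poly_Mapping.lookup v 2} =
        card {v \<in> monomials_deg 5 j. \<not> lex_ge A b c (Poly_Mapping.lookup v 1)
          (Poly_Mapping.lookup v 2) (Poly_Mapping.lookup v 3) (Poly_Mapping.lookup v 4)}"
      by (simp only: card_monomials_deg_5[of j "\<lambda>p q r t. \<not> d \<le> p + q"]
          card_monomials_deg_5[of j "\<lambda>p q r t. \<not> lex_ge A b c p q r t"])
    from card_Collect_not[OF finite_monomials_deg this] show ?thesis
      unfolding ideal_part_def lex_part_def .
  qed
  have "gotzmann_monomial TYPE('k) 5 (Poly_Mapping.single 2 d + Poly_Mapping.single 5 s) \<longleftrightarrow>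
      N - d \<le> s" for s
    unfolding gotzmann_monomial_iff
  proof
    assume *: "\<forall>j\<ge>d + s. card (ideal_part d (Suc j)) = lexgrowth j (card (ideal_part d j))"
    show "N - d \<le> s"
    proof (rule ccontr)
      assume "\<not> N - d \<le> s"
      \<comment> \<open>Here \<open>d + s < N\<close>, so the condition reaches degree
        \<open>j = N - 1\<close>, where the growth is not minimal.\<close>
      then obtain j where j: "N = Suc j" "d + s \<le> j" by (cases N) auto
      with * have "card (lex_part A b c (Suc j)) = lexgrowth j (card (lex_part A b c j))"
        using card_eq[of j] card_eq[of "Suc j"] by simp
      with lexgrowth_lex_part_less[of j A b c] j N show False by simp
    qed
  next
    assume "N - d \<le> s"
    then show "\<forall>j\<ge>d + s. card (ideal_part d (Suc j)) = lexgrowth j (card (ideal_part d j))"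
      using lexgrowth_lex_part[OF _ c] N by (simp add: card_eq)
  qed
  then have "gotzmann_threshold TYPE('k) 5 (Poly_Mapping.single 2 d) = N - d"
    by (rule gotzmann_threshold_eqI)
  moreover have "int (N - d) = int ((b + m) choose 2) - int (m choose 3) + int ((d + 3) choose 4) - int d"
    using ge unfolding N_def by linarith
  ultimately show ?thesis unfolding b_def m_def by simp
qed

end
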